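(* There exists an absolute constant $C>0$ such that for all integers $k\ge 2$ and $d\ge1$, the price of explainability $\rho_{k,d}$ of the $k$-centers problem in $\mathbb{R}^d$ satisfies $\rho_{k,d}\le C\sqrt{d}\,k^{1-1/d}$.
   Context: An instance of the $k$-centers problem is a finite set $X\subset\mathbb{R}^d$ of $n\ge k$ points, with $k\ge2$. A $k$-clustering is a partition $\mathcal{C}=(C_1,\dots,C_k)$ of $X$ into $k$ groups together with a representative $\mu(C_i)\in\mathbb{R}^d$ for each group; its cost is $cost(\mathcal{C})=\max_{i}\max_{x\in C_i}\|x-\mu(C_i)\|_2$. A standard decision tree is a binary tree in which each internal node $v$ is associated with a cut $(i_v,\theta_v)$, $i_v\in\{1,\dots,d\}$, $\theta_v\in\mathbb{R}$; the points reaching $v$ with $i_v$-th coordinate $\le\theta_v$ go to one child and those with $i_v$-th coordinate $>\theta_v$ go to the other. A $k$-clustering is explainable if its partition is the one induced on $X$ by the leaves of a standard decision tree with $k$ leaves (representatives may be arbitrary points of $\mathbb{R}^d$). $OPT_{unr}(X)$ is the minimum cost over all $k$-clusterings of $X$, $OPT_{exp}(X)$ is the minimum cost over all explainable $k$-clusterings of $X$. The price of explainability is $\rho_{k,d}=\sup_X OPT_{exp}(X)/OPT_{unr}(X)$, over all instances $X\subset\mathbb{R}^d$ with $OPT_{unr}(X)>0$. *)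

theory Defs
  imports "HOL-Analysis.Analysis" "HOL-Library.Disjoint_Sets"
begin

(* The dimension is quantified inside the statement, so it cannot be a type index: a point of R^d is
   an element of the carrier topspace (Euclidean_space d), i.e. a function nat => real vanishing at
   all indices >= d.  Coordinates are numbered 0, ..., d - 1. *)

type_synonym point = "nat \<Rightarrow> real"

definition euclidean_dist :: "nat \<Rightarrow> point \<Rightarrow> point \<Rightarrow> real" where
  "euclidean_dist d x y = L2_set (\<lambda>i. x i - y i) {..<d}"

definition kcenters_instance :: "nat \<Rightarrow> nat \<Rightarrow> point set \<Rightarrow> bool" where
  "kcenters_instance d k X \<longleftrightarrow>
     finite X \<and> X \<subseteq> topspace (Euclidean_space d) \<and> k \<le> card X"

(* The groups are nonempty, as part of partition_on; mu assigns a representative to each group. *)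

definition clustering ::
  "nat \<Rightarrow> nat \<Rightarrow> point set \<Rightarrow> point set set \<Rightarrow> (point set \<Rightarrow> point) \<Rightarrow> bool" where
  "clustering d k X P \<mu> \<longleftrightarrow>
     partition_on X P \<and> card P = k \<and> (\<forall>C\<in>P. \<mu> C \<in> topspace (Euclidean_space d))"

definition clustering_cost :: "nat \<Rightarrow> point set set \<Rightarrow> (point set \<Rightarrow> point) \<Rightarrow> real" where
  "clustering_cost d P \<mu> = (MAX C\<in>P. MAX x\<in>C. euclidean_dist d x (\<mu> C))"

datatype decision_tree = Leaf | Cut nat real decision_tree decision_tree

fun valid_tree :: "nat \<Rightarrow> decision_tree \<Rightarrow> bool" where
  "valid_tree d Leaf \<longleftrightarrow> True"
| "valid_tree d (Cut i \<theta> l r) \<longleftrightarrow> i < d \<and> valid_tree d l \<and> valid_tree d r"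

fun num_leaves :: "decision_tree \<Rightarrow> nat" where
  "num_leaves Leaf = 1"
| "num_leaves (Cut i \<theta> l r) = num_leaves l + num_leaves r"

(* leaf_groups t X is the family of the sets of points of X reaching the leaves of t. *)

fun leaf_groups :: "decision_tree \<Rightarrow> point set \<Rightarrow> point set set" where
  "leaf_groups Leaf X = {X}"
| "leaf_groups (Cut i \<theta> l r) X =
     leaf_groups l {x \<in> X. x i \<le> \<theta>} \<union> leaf_groups r {x \<in> X. x i > \<theta>}"

definition explainable :: "nat \<Rightarrow> nat \<Rightarrow> point set \<Rightarrow> point set set \<Rightarrow> bool" where
  "explainable d k X P \<longleftrightarrow>
     (\<exists>t. valid_tree d t \<and> num_leaves t = k \<and> P = leaf_groups t X)"

(* Both infima are minima for an instance with d >= 1 and k >= 1: there are finitely many partitions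
   (at least one of them explainable, since distinct points can be separated by axis-parallel cuts),
   and optimal representatives exist for each of them by compactness. *)

definition OPT_unr :: "nat \<Rightarrow> nat \<Rightarrow> point set \<Rightarrow> real" where
  "OPT_unr d k X = Inf {clustering_cost d P \<mu> | P \<mu>. clustering d k X P \<mu>}"

definition OPT_exp :: "nat \<Rightarrow> nat \<Rightarrow> point set \<Rightarrow> real" where
  "OPT_exp d k X =
     Inf {clustering_cost d P \<mu> | P \<mu>. clustering d k X P \<mu> \<and> explainable d k X P}"

definition price_of_explainability :: "nat \<Rightarrow> nat \<Rightarrow> ereal" where
  "price_of_explainability k d =
     (SUP X \<in> {X. kcenters_instance d k X \<and> OPT_unr d k X > 0}.
        ereal (OPT_exp d k X / OPT_unr d k X))"

end

theory Submission
  imports Defs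
begin

text \<open>
  Fix a clustering of cost \<open>r\<close> and cut as long as some axis-parallel cut separates two of the
  remaining centers but no point from its center. When no such cut is left at a node holding \<open>m\<close>
  centers, in every coordinate the intervals of radius \<open>r\<close> around the centers form a connected
  set, so the points of the node lie in a box with sides at most \<open>2rm\<close>. As clean cuts also split
  the budget of leaves, there are \<open>m\<close> leaves to spend at this node: a grid with
  \<open>\<lfloor>m\<^bsup>1/d\<^esup>\<rfloor>\<close> slabs in each coordinate has cells with sides at most \<open>4rm\<^bsup>1-1/d\<^esup>\<close>.
  Removing empty leaves and splitting leaves further yields exactly \<open>k\<close> groups.
\<close>

section \<open>Cutting a set within a budget of leaves\<close>

text \<open>The number of leaves is only bounded from above and leaves may be empty, so that budgets
  add under cuts and multiply under grafting; the exact count is restored at the very end.\<close>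

definition splittable :: "nat \<Rightarrow> nat \<Rightarrow> (point set \<Rightarrow> bool) \<Rightarrow> point set \<Rightarrow> bool" where
  "splittable d n Q X \<longleftrightarrow>
     (\<exists>t. valid_tree d t \<and> num_leaves t \<le> n \<and> (\<forall>G\<in>leaf_groups t X. Q G))"

text \<open>The diameter bound is relative to a set \<open>I\<close> of coordinates because the grid
  is built one coordinate at a time.\<close>

definition spread_le :: "nat set \<Rightarrow> real \<Rightarrow> point set \<Rightarrow> bool" where
  "spread_le I L G \<longleftrightarrow> (\<forall>x\<in>G. \<forall>y\<in>G. \<forall>i\<in>I. \<bar>x i - y i\<bar> \<le> L)"

lemma spread_le_slab:
  assumes "\<forall>x\<in>G. a \<le> x i \<and> x i \<le> a + w"
  shows "spread_le {i} w G"
  unfolding spread_le_def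
proof (intro ballI)
  fix x y j assume "x \<in> G" "y \<in> G" "j \<in> {i}"
  with assms have "a \<le> x j" "x j \<le> a + w" "a \<le> y j" "y j \<le> a + w" by auto
  then show "\<bar>x j - y j\<bar> \<le> w" by linarith
qed

lemma spread_le_mono: "spread_le I L G \<Longrightarrow> L \<le> L' \<Longrightarrow> spread_le I L' G"
  unfolding spread_le_def by (meson order_trans)

lemma splittable_leaf: "Q X \<Longrightarrow> 1 \<le> n \<Longrightarrow> splittable d n Q X"
  unfolding splittable_def by (intro exI[of _ Leaf]) auto

lemma splittable_cut:
  assumes "i < d" "splittable d n1 Q {x \<in> X. x i \<le> \<theta>}" "splittable d n2 Q {x \<in> X. x i > \<theta>}"
  shows "splittable d (n1 + n2) Q X"
proof -
  obtain l r where "valid_tree d l" "num_leaves l \<le> n1" "\<forall>G\<in>leaf_groups l {x \<in> X. x i \<le> \<theta>}. Q G"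
    "valid_tree d r" "num_leaves r \<le> n2" "\<forall>G\<in>leaf_groups r {x \<in> X. x i > \<theta>}. Q G"
    using assms unfolding splittable_def by blast
  then show ?thesis
    unfolding splittable_def using assms(1) by (intro exI[of _ "Cut i \<theta> l r"]) auto
qed

lemma splittable_mono:
  assumes "splittable d n Q X" "n \<le> n'" "\<And>G. Q G \<Longrightarrow> Q' G"
  shows "splittable d n' Q' X"
  using assms unfolding splittable_def by (meson order_trans)

text \<open>A tree with at most \<open>m\<close> leaves is grafted onto each leaf of
  \<open>t\<close>.\<close>

lemma splittable_leaf_groups:
  assumes "valid_tree d t" "\<forall>G\<in>leaf_groups t X. splittable d m Q G"
  shows "splittable d (num_leaves t * m) Q X"
  using assms
proof (induction t arbitrary: X)
  case Leaf
  then show ?case by simp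
next
  case (Cut i \<theta> l r)
  then show ?case
    using splittable_cut[of i d "num_leaves l * m" Q X \<theta> "num_leaves r * m"]
    by (auto simp: algebra_simps)
qed

lemma splittable_trans:
  assumes "splittable d n (splittable d m Q) X"
  shows "splittable d (n * m) Q X"
proof -
  obtain t where "valid_tree d t" "num_leaves t \<le> n" "\<forall>G\<in>leaf_groups t X. splittable d m Q G"
    using assms unfolding splittable_def by blast
  then show ?thesis
    using splittable_mono[OF splittable_leaf_groups, of d t X m Q "n * m" Q] by simp
qed

section \<open>Grid subdivision\<close>

text \<open>The cut at \<open>a + w\<close> peels off the lowest slab, and the rest starts at
  \<open>a + w\<close> with one slab fewer. Keeping \<open>G \<subseteq> X\<close> in the predicate
  lets the groups inherit spread bounds known for \<open>X\<close> in other coordinates.\<close>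

lemma splittable_slabs:
  assumes "i < d" "w \<ge> 0" "\<forall>x\<in>X. a \<le> x i \<and> x i \<le> a + real (Suc m) * w"
  shows "splittable d (Suc m) (\<lambda>G. G \<subseteq> X \<and> spread_le {i} w G) X"
  using assms(3)
proof (induction m arbitrary: a X)
  case 0
  then show ?case
    by (intro splittable_leaf conjI spread_le_slab[of _ a]) auto
next
  case (Suc m)
  have "splittable d 1 (\<lambda>G. G \<subseteq> X \<and> spread_le {i} w G) {x \<in> X. x i \<le> a + w}"
    using Suc.prems by (intro splittable_leaf conjI spread_le_slab[of _ a]) auto
  moreover have "splittable d (Suc m) (\<lambda>G. G \<subseteq> {x \<in> X. x i > a + w} \<and> spread_le {i} w G)
      {x \<in> X. x i > a + w}"
    using Suc.prems by (intro Suc.IH[of _ "a + w"]) (auto simp: algebra_simps)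
  then have "splittable d (Suc m) (\<lambda>G. G \<subseteq> X \<and> spread_le {i} w G) {x \<in> X. x i > a + w}"
    by (rule splittable_mono) auto
  ultimately show ?case
    using splittable_cut[OF assms(1), of 1 _ X "a + w" "Suc m"] by simp
qed

lemma splittable_coordinate:
  assumes "finite X" "i < d" "m \<ge> 1" "L \<ge> 0" "spread_le {i} L X"
  shows "splittable d m (\<lambda>G. G \<subseteq> X \<and> spread_le {i} (L / m) G) X"
proof (cases "X = {}")
  case True
  then show ?thesis using assms(3) by (intro splittable_leaf) (auto simp: spread_le_def)
next
  case False
  \<comment> \<open>The slabs start at the smallest coordinate, so a spread of \<open>L\<close>
    places \<open>X\<close> in an interval of length \<open>L\<close>; the minimum needs
    \<open>X\<close> nonempty, hence the case distinction.\<close>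
  define a where "a = Min ((\<lambda>x. x i) ` X)"
  have "a \<in> (\<lambda>x. x i) ` X"
    unfolding a_def using assms(1) False by (intro Min_in) auto
  then obtain z where z: "z \<in> X" "a = z i" by auto
  have "a \<le> x i \<and> x i \<le> a + real (Suc (m - 1)) * (L / m)" if "x \<in> X" for x
  proof
    show "a \<le> x i" unfolding a_def using assms(1) that by simp
    have "\<bar>x i - z i\<bar> \<le> L" using assms(5) that z(1) by (auto simp: spread_le_def)
    then show "x i \<le> a + real (Suc (m - 1)) * (L / m)" using z(2) assms(3) by simp
  qed
  then have "splittable d (Suc (m - 1)) (\<lambda>G. G \<subseteq> X \<and> spread_le {i} (L / m) G) X"
    using assms by (intro splittable_slabs) auto
  then show ?thesis using assms(3) by simp
qed

text \<open>Induction on the number \<open>j\<close> of coordinates already subdivided: each cell is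
  cut into \<open>m\<close> slabs along coordinate \<open>j\<close>, and being subsets of the cell
  these keep the bounds in the earlier coordinates.\<close>

lemma splittable_grid:
  assumes "finite X" "m \<ge> 1" "L \<ge> 0" "spread_le {..<d} L X" "j \<le> d"
  shows "splittable d (m ^ j) (\<lambda>G. G \<subseteq> X \<and> spread_le {..<j} (L / m) G) X"
  using assms(5)
proof (induction j)
  case 0
  then show ?case by (intro splittable_leaf) (auto simp: spread_le_def)
next
  case (Suc j)
  have "splittable d m (\<lambda>H. H \<subseteq> X \<and> spread_le {..<Suc j} (L / m) H) G"
    if "G \<subseteq> X \<and> spread_le {..<j} (L / m) G" for G
  proof -
    have "spread_le {j} L G"
      using that assms(4) Suc.prems by (fastforce simp: spread_le_def)
    then have "splittable d m (\<lambda>H. H \<subseteq> G \<and> spread_le {j} (L / m) H) G"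
      using that assms Suc.prems by (intro splittable_coordinate) (auto intro: finite_subset)
    then show ?thesis
    proof (rule splittable_mono)
      fix H assume "H \<subseteq> G \<and> spread_le {j} (L / m) H"
      then show "H \<subseteq> X \<and> spread_le {..<Suc j} (L / m) H"
        using that unfolding spread_le_def lessThan_Suc by blast
    qed simp
  qed
  with Suc have "splittable d (m ^ j)
      (splittable d m (\<lambda>H. H \<subseteq> X \<and> spread_le {..<Suc j} (L / m) H)) X"
    by (auto elim: splittable_mono)
  from splittable_trans[OF this] show ?case by (simp add: mult.commute)
qed

section \<open>Clean cuts, and boxes in which none is left\<close>

text \<open>Consecutive elements of \<open>T\<close> differ by at most \<open>2 * r\<close>, since
  otherwise a threshold between them would keep distance \<open>r\<close> from both sides; there are
  \<open>card T - 1\<close> such steps. The induction adds a new minimum \<open>b\<close> each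
  time.\<close>

lemma diameter_le_if_no_gap:
  fixes T :: "real set"
  assumes "finite T" "r \<ge> 0"
    and "\<nexists>\<theta>. (\<forall>s\<in>T. s \<le> \<theta> - r \<or> s > \<theta> + r) \<and> (\<exists>s\<in>T. s \<le> \<theta>) \<and> (\<exists>s\<in>T. s > \<theta>)"
    and "x \<in> T" "y \<in> T"
  shows "x - y \<le> 2 * r * (real (card T) - 1)"
  using assms(1,3-5)
proof (induction T arbitrary: x y rule: finite_linorder_min_induct)
  case empty
  then show ?case by simp
next
  case (insert b A)
  have gap: "False" if "\<forall>s\<in>insert b A. s \<le> \<theta> - r \<or> s > \<theta> + r"
      "\<exists>s\<in>insert b A. s \<le> \<theta>" "\<exists>s\<in>insert b A. s > \<theta>" for \<theta>
    using insert.prems(1) that by blast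
  have card: "real (card (insert b A)) = real (card A) + 1"
    using insert.hyps by (subst card_insert_disjoint) auto
  show ?case
  proof (cases "A = {}")
    case True
    then show ?thesis using insert.prems by simp
  next
    case False
    define c where "c = Min A"
    have c: "c \<in> A" "\<And>s. s \<in> A \<Longrightarrow> c \<le> s"
      unfolding c_def using insert.hyps False by auto
    \<comment> \<open>Otherwise \<open>b + r\<close> is a forbidden threshold: \<open>b\<close>
      satisfies the non-strict condition on the left with equality, and all of \<open>A\<close> lies
      strictly beyond \<open>b + 2 * r\<close>.\<close>
    have "c \<le> b + 2 * r"
    proof (rule ccontr)
      assume "\<not> c \<le> b + 2 * r"
      then show False
        using c assms(2) by (intro gap[of "b + r"]) (force intro: bexI[of _ c])+
    qed
    have no_gap: "\<nexists>\<theta>. (\<forall>s\<in>A. s \<le> \<theta> - r \<or> s > \<theta> + r) \<and> (\<exists>s\<in>A. s \<le> \<theta>) \<and> (\<exists>s\<in>A. s > \<theta>)"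
    proof
      assume "\<exists>\<theta>. (\<forall>s\<in>A. s \<le> \<theta> - r \<or> s > \<theta> + r) \<and> (\<exists>s\<in>A. s \<le> \<theta>) \<and> (\<exists>s\<in>A. s > \<theta>)"
      then obtain \<theta> u where \<theta>: "\<forall>s\<in>A. s \<le> \<theta> - r \<or> s > \<theta> + r" "u \<in> A" "u \<le> \<theta>" "\<exists>s\<in>A. s > \<theta>"
        by blast
      \<comment> \<open>A threshold for \<open>A\<close> also works after \<open>b\<close> is added,
        because \<open>b\<close> lies below an element that is already on the left.\<close>
      have "b < u" "u \<le> \<theta> - r"
        using insert.hyps \<theta> assms(2) by force+
      then show False
        using \<theta> assms(2) by (intro gap[of \<theta>]) auto
    qed
    note IH = insert.IH[OF no_gap]
    have "1 \<le> card A" using insert.hyps(1) False by (simp add: Suc_leI card_gt_0_iff)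
    then have nonneg: "0 \<le> 2 * r * (real (card A) - 1)" using assms(2) by simp
    have "b < c" using insert.hyps c(1) by simp
    have expand: "2 * r * (real (card (insert b A)) - 1) = 2 * r * (real (card A) - 1) + 2 * r"
      by (simp add: card algebra_simps)
    consider "x \<in> A" "y \<in> A" | "x \<in> A" "y = b" | "x = b" "y \<in> A" | "x = b" "y = b"
      using insert.prems by blast
    then show ?thesis
    proof cases
      case 1
      then show ?thesis using IH[of x y] expand assms(2) by linarith
    next
      case 2
      then show ?thesis using IH[of x c] c(1) \<open>c \<le> b + 2 * r\<close> expand by linarith
    next
      case 3
      then have "b < y" using insert.hyps by simp
      then show ?thesis using 3 nonneg expand assms(2) by linarith
    next
      case 4
      then show ?thesis using nonneg expand assms(2) by linarith
    qed
  qed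
qed

text \<open>Rounding a number that is at least 1 down to an integer loses less than a factor 2, so
  \<open>m / q\<close> is at most twice \<open>m\<close> divided by its \<open>d\<close>-th
  root.\<close>

lemma floor_root_bounds:
  fixes m d :: nat
  assumes "m \<ge> 1" "d \<ge> 1"
  defines "q \<equiv> nat \<lfloor>real m powr (1 / d)\<rfloor>"
  shows "q \<ge> 1" "q ^ d \<le> m" "real m / q \<le> 2 * real m powr (1 - 1 / d)"
proof -
  let ?y = "real m powr (1 / d)"
  have y: "?y \<ge> 1" using assms(1) by (simp add: ge_one_powr_ge_zero)
  have q_le: "real q \<le> ?y" and q_gt: "?y < real q + 1"
    unfolding q_def using y by linarith+
  show q1: "q \<ge> 1" unfolding q_def using y by linarith
  have "real (q ^ d) \<le> ?y ^ d" using q_le by (simp add: power_mono)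
  also have "\<dots> = ?y powr d" using y by (subst powr_realpow) (use y in linarith, simp)
  also have "\<dots> = m" using assms by (simp add: powr_powr)
  finally show "q ^ d \<le> m" by simp
  have "?y \<le> 2 * real q" using q_gt q1 by linarith
  then have "real m / q \<le> real m / (?y / 2)" using y q1
    by (intro divide_left_mono mult_pos_pos) linarith+
  also have "\<dots> = 2 * real m powr (1 - 1 / d)"
    using assms(1) by (simp add: powr_diff)
  finally show "real m / q \<le> 2 * real m powr (1 - 1 / d)" .
qed

text \<open>Induction on the number of centers: a clean cut splits \<open>S\<close> into two smaller
  nonempty sets, whose sizes are the leaf budgets of the two sides; without a clean cut the whole
  budget goes into a grid. The map \<open>f\<close> sends a point to its center, and the fixed bound
  \<open>K\<close> keeps the target spread the same throughout the recursion.\<close>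

lemma splittable_around_centers:
  assumes "finite X" "finite S" "S \<noteq> {}" "r \<ge> 0" "d \<ge> 1" "card S \<le> K"
    and "\<And>x. x \<in> X \<Longrightarrow> f x \<in> S" "\<And>x i. x \<in> X \<Longrightarrow> i < d \<Longrightarrow> \<bar>x i - f x i\<bar> \<le> r"
  shows "splittable d (card S) (spread_le {..<d} (4 * r * real K powr (1 - 1 / d))) X"
  using assms(1-3,6-8)
proof (induction "card S" arbitrary: S X rule: less_induct)
  case less
  let ?Q = "spread_le {..<d} (4 * r * real K powr (1 - 1 / d))"
  have m: "card S \<ge> 1" using less.prems by (simp add: Suc_leI card_gt_0_iff)
  show ?case
  proof (cases "\<exists>i \<theta>. i < d \<and> (\<forall>s\<in>S. s i \<le> \<theta> - r \<or> s i > \<theta> + r) \<and>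
      (\<exists>s\<in>S. s i \<le> \<theta>) \<and> (\<exists>s\<in>S. s i > \<theta>)")
    case True
    then obtain i \<theta> where cut: "i < d" "\<forall>s\<in>S. s i \<le> \<theta> - r \<or> s i > \<theta> + r"
      "\<exists>s\<in>S. s i \<le> \<theta>" "\<exists>s\<in>S. s i > \<theta>" by blast
    define S1 S2 where S12: "S1 = {s \<in> S. s i \<le> \<theta>}" "S2 = {s \<in> S. s i > \<theta>}"
    have "S1 \<inter> S2 = {}" "S = S1 \<union> S2" "finite S1" "finite S2" "S1 \<noteq> {}" "S2 \<noteq> {}"
      using cut less.prems(2) unfolding S12 by auto
    then have card: "card S = card S1 + card S2" "0 < card S1" "0 < card S2"
      using card_Un_disjoint by (simp_all add: card_gt_0_iff)
    \<comment> \<open>A point is within \<open>r\<close> of its center in coordinate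
      \<open>i\<close>, so a center at most \<open>\<theta> - r\<close> forces the point to be at
      most \<open>\<theta>\<close>, and a center above \<open>\<theta> + r\<close> forces it above
      \<open>\<theta>\<close>.\<close>
    have clean: "f x i \<le> \<theta> \<longleftrightarrow> x i \<le> \<theta>" if "x \<in> X" for x
      using cut(2) less.prems(5)[OF that] less.prems(6)[OF that cut(1)] assms(4) by force
    have "splittable d (card S1) ?Q {x \<in> X. x i \<le> \<theta>}"
    proof (rule less.hyps)
      show "f x \<in> S1" if "x \<in> {x \<in> X. x i \<le> \<theta>}" for x
        using that clean less.prems(5) by (auto simp: S12)
    qed (use card \<open>finite S1\<close> \<open>S1 \<noteq> {}\<close> less.prems in auto)
    moreover have "splittable d (card S2) ?Q {x \<in> X. x i > \<theta>}"
    proof (rule less.hyps)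
      show "f x \<in> S2" if "x \<in> {x \<in> X. x i > \<theta>}" for x
        using that clean[of x] less.prems(5) by (auto simp: S12)
    qed (use card \<open>finite S2\<close> \<open>S2 \<noteq> {}\<close> less.prems in auto)
    ultimately show ?thesis
      unfolding card(1) using cut(1) by (rule splittable_cut[rotated])
  next
    case False
    have "\<bar>x i - y i\<bar> \<le> 2 * r * card S" if xy: "x \<in> X" "y \<in> X" and i: "i < d" for x y i
    proof -
      let ?T = "(\<lambda>s. s i) ` S"
      have "\<nexists>\<theta>. (\<forall>s\<in>?T. s \<le> \<theta> - r \<or> s > \<theta> + r) \<and> (\<exists>s\<in>?T. s \<le> \<theta>) \<and> (\<exists>s\<in>?T. s > \<theta>)"
        using False i by auto
      note diam = diameter_le_if_no_gap[OF finite_imageI[OF less.prems(2)] assms(4) this]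
      \<comment> \<open>Distinct centers may share a coordinate, so the projection can be smaller
        than \<open>S\<close>. The \<open>2 * r\<close> saved by the \<open>- 1\<close> pays for the
        distances of the two points from their centers.\<close>
      have "2 * r * (real (card ?T) - 1) \<le> 2 * r * (real (card S) - 1)"
        using less.prems(2) assms(4) by (intro mult_left_mono) (auto intro: card_image_le)
      then have "f x i - f y i \<le> 2 * r * card S - 2 * r" "f y i - f x i \<le> 2 * r * card S - 2 * r"
        using diam[of "f x i" "f y i"] diam[of "f y i" "f x i"] less.prems(5) xy
        by (auto simp: algebra_simps)
      then show ?thesis
        using less.prems(6)[OF xy(1) i] less.prems(6)[OF xy(2) i] by linarith
    qed
    then have spread: "spread_le {..<d} (2 * r * card S) X"
      by (auto simp: spread_le_def)
    define q where "q = nat \<lfloor>real (card S) powr (1 / d)\<rfloor>"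
    have q: "q \<ge> 1" "q ^ d \<le> card S" "real (card S) / q \<le> 2 * real (card S) powr (1 - 1 / d)"
      unfolding q_def using floor_root_bounds[OF m assms(5)] by auto
    have "real (card S) powr (1 - 1 / d) \<le> real K powr (1 - 1 / d)"
      using less.prems(4) assms(5) by (intro powr_mono2) auto
    then have "2 * r * (real (card S) / q) \<le> 2 * r * (2 * real K powr (1 - 1 / d))"
      using q(3) assms(4) by (intro mult_left_mono) auto
    then have side: "2 * r * card S / q \<le> 4 * r * real K powr (1 - 1 / d)" by simp
    have "splittable d (q ^ d) (\<lambda>G. G \<subseteq> X \<and> spread_le {..<d} (2 * r * card S / q) G) X"
      using less.prems(1) q(1) assms(4) spread by (intro splittable_grid) auto
    then show ?thesis
      using q(2) by (rule splittable_mono) (use side spread_le_mono in blast)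
  qed
qed

section \<open>Trees with exactly k nonempty leaves\<close>

lemma leaf_groups_empty [simp]: "leaf_groups t {} = {{}}"
  by (induction t) auto

text \<open>A cut with all points on one side is replaced by the subtree of that side; the discarded
  subtree contributes only the empty group.\<close>

lemma remove_empty_leaves:
  assumes "valid_tree d t" "X \<noteq> {}"
  shows "\<exists>t'. valid_tree d t' \<and> num_leaves t' \<le> num_leaves t \<and>
    leaf_groups t' X = leaf_groups t X - {{}}"
  using assms
proof (induction t arbitrary: X)
  case Leaf
  then show ?case by (intro exI[of _ Leaf]) auto
next
  case (Cut i \<theta> l r)
  let ?L = "{x \<in> X. x i \<le> \<theta>}" and ?R = "{x \<in> X. x i > \<theta>}"
  consider "?L = {}" "?R = X" | "?R = {}" "?L = X" | "?L \<noteq> {}" "?R \<noteq> {}"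
    by fastforce
  then show ?case
  proof cases
    case 1
    obtain r' where r': "valid_tree d r'" "num_leaves r' \<le> num_leaves r"
      "leaf_groups r' X = leaf_groups r X - {{}}"
      using Cut.IH(2)[of X] Cut.prems by auto
    have "leaf_groups (Cut i \<theta> l r) X = insert {} (leaf_groups r X)"
      unfolding leaf_groups.simps 1 by simp
    with r' show ?thesis by (intro exI[of _ r']) auto
  next
    case 2
    obtain l' where l': "valid_tree d l'" "num_leaves l' \<le> num_leaves l"
      "leaf_groups l' X = leaf_groups l X - {{}}"
      using Cut.IH(1)[of X] Cut.prems by auto
    have "leaf_groups (Cut i \<theta> l r) X = insert {} (leaf_groups l X)"
      unfolding leaf_groups.simps 2 by simp
    with l' show ?thesis by (intro exI[of _ l']) auto
  next
    case 3
    obtain l' where l': "valid_tree d l'" "num_leaves l' \<le> num_leaves l"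
      "leaf_groups l' ?L = leaf_groups l ?L - {{}}"
      using Cut.IH(1)[OF _ 3(1)] Cut.prems by auto
    obtain r' where r': "valid_tree d r'" "num_leaves r' \<le> num_leaves r"
      "leaf_groups r' ?R = leaf_groups r ?R - {{}}"
      using Cut.IH(2)[OF _ 3(2)] Cut.prems by auto
    from l' r' show ?thesis
      using Cut.prems by (intro exI[of _ "Cut i \<theta> l' r'"]) auto
  qed
qed

lemma card_split_threshold:
  fixes X :: "point set"
  assumes "finite X"
  shows "card X = card {x \<in> X. x i \<le> \<theta>} + card {x \<in> X. x i > \<theta>}"
proof -
  have "card ({x \<in> X. x i \<le> \<theta>} \<union> {x \<in> X. x i > \<theta>}) = card {x \<in> X. x i \<le> \<theta>} + card {x \<in> X. x i > \<theta>}"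
    using assms by (intro card_Un_disjoint) auto
  moreover have "{x \<in> X. x i \<le> \<theta>} \<union> {x \<in> X. x i > \<theta>} = X" by auto
  ultimately show ?thesis by simp
qed

text \<open>By pigeonhole some leaf receives two points and can be cut further. The recursion finds
  it by descending into a child that has more points than leaves.\<close>

lemma split_one_leaf:
  assumes "valid_tree d t" "{} \<notin> leaf_groups t X" "finite X" "X \<subseteq> topspace (Euclidean_space d)"
    and "num_leaves t < card X"
  shows "\<exists>t'. valid_tree d t' \<and> {} \<notin> leaf_groups t' X \<and> num_leaves t' = Suc (num_leaves t) \<and>
    (\<forall>G\<in>leaf_groups t' X. \<exists>H\<in>leaf_groups t X. G \<subseteq> H)"
  using assms
proof (induction t arbitrary: X)
  case Leaf
  then have "\<not> card X \<le> Suc 0" by simp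
  then obtain x y where xy: "x \<in> X" "y \<in> X" "x \<noteq> y"
    using card_le_Suc0_iff_eq[OF Leaf.prems(3)] by blast
  then obtain i where i: "x i \<noteq> y i" by auto
  \<comment> \<open>Points vanish at all indices from \<open>d\<close> on, so two of them can differ
    only in a genuine coordinate.\<close>
  have "i < d"
  proof (rule ccontr)
    assume "\<not> i < d"
    moreover have "x \<in> topspace (Euclidean_space d)" "y \<in> topspace (Euclidean_space d)"
      using xy Leaf.prems(4) by auto
    ultimately show False using i by (simp add: topspace_Euclidean_space)
  qed
  \<comment> \<open>With the smaller value as threshold, the non-strict side receives one of the two
    points and the strict side the other, so both new leaves are nonempty.\<close>
  define \<theta> where "\<theta> = min (x i) (y i)"
  have "(x i \<le> \<theta> \<and> y i > \<theta>) \<or> (y i \<le> \<theta> \<and> x i > \<theta>)"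
    using i unfolding \<theta>_def by auto
  then show ?case
    using \<open>i < d\<close> xy by (intro exI[of _ "Cut i \<theta> Leaf Leaf"]) auto
next
  case (Cut i \<theta> l r)
  let ?L = "{x \<in> X. x i \<le> \<theta>}" and ?R = "{x \<in> X. x i > \<theta>}"
  have "num_leaves l < card ?L \<or> num_leaves r < card ?R"
    using Cut.prems(5) card_split_threshold[OF Cut.prems(3), of i \<theta>] by simp linarith
  then show ?case
  proof
    assume "num_leaves l < card ?L"
    moreover have "?L \<subseteq> topspace (Euclidean_space d)" using Cut.prems(4) by blast
    ultimately obtain l' where "valid_tree d l'" "{} \<notin> leaf_groups l' ?L"
      "num_leaves l' = Suc (num_leaves l)" "\<forall>G\<in>leaf_groups l' ?L. \<exists>H\<in>leaf_groups l ?L. G \<subseteq> H"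
      using Cut.IH(1)[of ?L] Cut.prems by auto
    then show ?thesis
      using Cut.prems by (intro exI[of _ "Cut i \<theta> l' r"]) (simp add: ball_Un bex_Un, blast)
  next
    assume "num_leaves r < card ?R"
    moreover have "?R \<subseteq> topspace (Euclidean_space d)" using Cut.prems(4) by blast
    ultimately obtain r' where "valid_tree d r'" "{} \<notin> leaf_groups r' ?R"
      "num_leaves r' = Suc (num_leaves r)" "\<forall>G\<in>leaf_groups r' ?R. \<exists>H\<in>leaf_groups r ?R. G \<subseteq> H"
      using Cut.IH(2)[of ?R] Cut.prems by auto
    then show ?thesis
      using Cut.prems by (intro exI[of _ "Cut i \<theta> l r'"]) (simp add: ball_Un bex_Un, blast)
  qed
qed

text \<open>Leaves are split one at a time. The inclusion of new groups in old ones is what carries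
  diameter bounds over to the refined tree.\<close>

lemma refine_to_num_leaves:
  assumes "valid_tree d t" "{} \<notin> leaf_groups t X" "finite X" "X \<subseteq> topspace (Euclidean_space d)"
    and "num_leaves t \<le> k" "k \<le> card X"
  shows "\<exists>t'. valid_tree d t' \<and> {} \<notin> leaf_groups t' X \<and> num_leaves t' = k \<and>
    (\<forall>G\<in>leaf_groups t' X. \<exists>H\<in>leaf_groups t X. G \<subseteq> H)"
  using assms(5,6)
proof (induction k rule: dec_induct)
  case base
  then show ?case using assms by auto
next
  case (step n)
  then obtain t' where t': "valid_tree d t'" "{} \<notin> leaf_groups t' X" "num_leaves t' = n"
    "\<forall>G\<in>leaf_groups t' X. \<exists>H\<in>leaf_groups t X. G \<subseteq> H" by auto
  then obtain t'' where "valid_tree d t''" "{} \<notin> leaf_groups t'' X" "num_leaves t'' = Suc n"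
    "\<forall>G\<in>leaf_groups t'' X. \<exists>H\<in>leaf_groups t' X. G \<subseteq> H"
    using split_one_leaf[OF t'(1,2) assms(3,4)] step.prems by auto
  with t'(4) show ?case by (meson order_trans)
qed

text \<open>\<open>leaf_groups\<close> is a set, so coinciding groups would be counted once. Groups
  of different leaves are disjoint, hence can coincide only if they are empty.\<close>

lemma partition_on_leaf_groups:
  assumes "{} \<notin> leaf_groups t X"
  shows "partition_on X (leaf_groups t X) \<and> card (leaf_groups t X) = num_leaves t"
  using assms
proof (induction t arbitrary: X)
  case Leaf
  then show ?case by (auto simp: partition_on_def)
next
  case (Cut i \<theta> l r)
  let ?L = "{x \<in> X. x i \<le> \<theta>}" and ?R = "{x \<in> X. x i > \<theta>}"
  have l: "partition_on ?L (leaf_groups l ?L)" "card (leaf_groups l ?L) = num_leaves l"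
    and r: "partition_on ?R (leaf_groups r ?R)" "card (leaf_groups r ?R) = num_leaves r"
    using Cut by auto
  have fin: "finite (leaf_groups s Y)" for s Y by (induction s arbitrary: Y) auto
  have disj: "?L \<inter> ?R = {}" and un: "?L \<union> ?R = X" by auto
  have "partition_on (?L \<union> ?R) (leaf_groups l ?L \<union> leaf_groups r ?R)"
    using l(1) r(1) disj by (simp add: partition_on_def disjoint_union)
  moreover have "leaf_groups l ?L \<inter> leaf_groups r ?R = {}"
  proof (rule ccontr)
    assume "leaf_groups l ?L \<inter> leaf_groups r ?R \<noteq> {}"
    then obtain p where "p \<in> leaf_groups l ?L" "p \<in> leaf_groups r ?R" by blast
    then have "p \<subseteq> ?L" "p \<subseteq> ?R" "p \<noteq> {}"
      using l(1) r(1) by (auto simp: partition_on_def)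
    then show False using disj by blast
  qed
  then have "card (leaf_groups l ?L \<union> leaf_groups r ?R) = num_leaves l + num_leaves r"
    using l(2) r(2) fin by (subst card_Un_disjoint) auto
  ultimately show ?case unfolding un by simp
qed

text \<open>Removing empty leaves and then refining gives exactly \<open>k\<close> groups.
  \<open>Q\<close> is asserted for a superset \<open>H\<close> of each group, as an arbitrary
  \<open>Q\<close> need not pass to subsets.\<close>

lemma explainable_clustering_exists:
  assumes "kcenters_instance d k X" "k \<ge> 1" "splittable d k Q X"
  shows "\<exists>P \<mu>. clustering d k X P \<mu> \<and> explainable d k X P \<and>
    (\<forall>G\<in>P. \<mu> G \<in> G \<and> (\<exists>H. Q H \<and> G \<subseteq> H))"
proof -
  have X: "finite X" "X \<subseteq> topspace (Euclidean_space d)" "k \<le> card X"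
    using assms(1) by (auto simp: kcenters_instance_def)
  then have "X \<noteq> {}" using assms(2) by auto
  obtain t where t: "valid_tree d t" "num_leaves t \<le> k" "\<forall>G\<in>leaf_groups t X. Q G"
    using assms(3) unfolding splittable_def by blast
  obtain s where s: "valid_tree d s" "num_leaves s \<le> num_leaves t"
      "leaf_groups s X = leaf_groups t X - {{}}"
    using remove_empty_leaves[OF t(1) \<open>X \<noteq> {}\<close>] by blast
  obtain u where u: "valid_tree d u" "{} \<notin> leaf_groups u X" "num_leaves u = k"
      "\<forall>G\<in>leaf_groups u X. \<exists>H\<in>leaf_groups s X. G \<subseteq> H"
    using refine_to_num_leaves[OF s(1) _ X(1,2), of k] s t(2) X(3) by auto
  note part = partition_on_leaf_groups[OF u(2)]
  \<comment> \<open>Any member of a group serves as its representative: its distance to the others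
    is at most the diameter.\<close>
  define \<mu> :: "point set \<Rightarrow> point" where "\<mu> G = (SOME x. x \<in> G)" for G
  have \<mu>: "\<mu> G \<in> G" if "G \<in> leaf_groups u X" for G
    unfolding \<mu>_def using u(2) that by (metis some_in_eq)
  have "clustering d k X (leaf_groups u X) \<mu>"
    unfolding clustering_def using part u(3) \<mu> X(2) by (auto simp: partition_on_def)
  moreover have "explainable d k X (leaf_groups u X)"
    unfolding explainable_def using u by blast
  moreover have "\<mu> G \<in> G \<and> (\<exists>H. Q H \<and> G \<subseteq> H)" if G: "G \<in> leaf_groups u X" for G
  proof -
    obtain H where "H \<in> leaf_groups s X" "G \<subseteq> H" using u(4) G by blast
    moreover have "Q H" using \<open>H \<in> leaf_groups s X\<close> s(3) t(3) by simp
    ultimately show ?thesis using \<mu>[OF G] by blast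
  qed
  ultimately show ?thesis
    by (intro exI[of _ "leaf_groups u X"] exI[of _ \<mu>] conjI ballI) blast+
qed

section \<open>Costs and the price of explainability\<close>

lemma
  assumes "clustering d k X P \<mu>" "finite X" "X \<noteq> {}"
  shows clustering_cost_ge: "\<And>C x. C \<in> P \<Longrightarrow> x \<in> C \<Longrightarrow> euclidean_dist d x (\<mu> C) \<le> clustering_cost d P \<mu>"
    and clustering_cost_le: "(\<And>C x. C \<in> P \<Longrightarrow> x \<in> C \<Longrightarrow> euclidean_dist d x (\<mu> C) \<le> B) \<Longrightarrow>
      clustering_cost d P \<mu> \<le> B"
    and clustering_cost_nonneg: "clustering_cost d P \<mu> \<ge> 0"
proof -
  have P: "finite P" "P \<noteq> {}" "{} \<notin> P" "\<And>C. C \<in> P \<Longrightarrow> finite C"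
    using assms finite_elements[of X P]
    by (auto simp: clustering_def partition_on_def intro: finite_subset)
  show ge: "euclidean_dist d x (\<mu> C) \<le> clustering_cost d P \<mu>" if "C \<in> P" "x \<in> C" for C x
  proof -
    have "euclidean_dist d x (\<mu> C) \<le> (MAX x\<in>C. euclidean_dist d x (\<mu> C))"
      using P that by simp
    also have "\<dots> \<le> clustering_cost d P \<mu>"
      unfolding clustering_cost_def using P that by (intro Max_ge) auto
    finally show ?thesis .
  qed
  show "clustering_cost d P \<mu> \<le> B"
    if B: "\<And>C x. C \<in> P \<Longrightarrow> x \<in> C \<Longrightarrow> euclidean_dist d x (\<mu> C) \<le> B"
  proof -
    have "(MAX x\<in>C. euclidean_dist d x (\<mu> C)) \<le> B" if "C \<in> P" for C
      using P that B by (subst Max_le_iff) auto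
    then show ?thesis
      unfolding clustering_cost_def using P by (subst Max_le_iff) auto
  qed
  obtain C x where "C \<in> P" "x \<in> C" using P(2,3) by (metis ex_in_conv)
  with ge[of C x] show "clustering_cost d P \<mu> \<ge> 0"
    by (auto simp: euclidean_dist_def intro: order_trans[OF L2_set_nonneg])
qed

lemma euclidean_dist_le:
  assumes "\<And>i. i < d \<Longrightarrow> \<bar>x i - y i\<bar> \<le> L" "L \<ge> 0"
  shows "euclidean_dist d x y \<le> sqrt d * L"
proof -
  have "(\<Sum>i<d. (x i - y i)\<^sup>2) \<le> (\<Sum>i<d. L\<^sup>2)"
    using assms by (intro sum_mono) (auto simp: abs_le_square_iff[symmetric])
  then have "euclidean_dist d x y \<le> sqrt (d * L\<^sup>2)"
    unfolding euclidean_dist_def L2_set_def by simp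
  then show ?thesis using assms(2) by (simp add: real_sqrt_mult)
qed

lemma OPT_exp_le_clustering_cost:
  assumes "kcenters_instance d k X" "k \<ge> 1" "d \<ge> 1" "clustering d k X P \<mu>"
  shows "OPT_exp d k X \<le> 4 * sqrt d * real k powr (1 - 1 / d) * clustering_cost d P \<mu>"
proof -
  define r where "r = clustering_cost d P \<mu>"
  define L where "L = 4 * r * real k powr (1 - 1 / d)"
  have X: "finite X" "X \<noteq> {}"
    using assms(1,2) by (auto simp: kcenters_instance_def)
  have "r \<ge> 0" unfolding r_def by (rule clustering_cost_nonneg[OF assms(4) X])
  then have "L \<ge> 0" unfolding L_def by simp
  have P: "\<Union> P = X" "card P = k" "finite P"
    using assms(4) finite_elements[OF X(1)] by (auto simp: clustering_def partition_on_def)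
  \<comment> \<open>Representatives of different groups may coincide, so \<open>S\<close> has at
    most \<open>k\<close> elements, not necessarily \<open>k\<close>.\<close>
  define S where "S = \<mu> ` P"
  have S: "finite S" "S \<noteq> {}" "card S \<le> k"
    unfolding S_def using P assms(2) by (auto simp: card_image_le)
  have "\<forall>x\<in>X. \<exists>C. C \<in> P \<and> x \<in> C" using P(1) by blast
  then obtain g where g: "\<And>x. x \<in> X \<Longrightarrow> g x \<in> P \<and> x \<in> g x"
    using bchoice[of X "\<lambda>x C. C \<in> P \<and> x \<in> C"] by blast
  have "\<bar>x i - \<mu> (g x) i\<bar> \<le> r" if "x \<in> X" "i < d" for x i
  proof -
    have "\<bar>x i - \<mu> (g x) i\<bar> \<le> euclidean_dist d x (\<mu> (g x))"
      unfolding euclidean_dist_def L2_set_def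
      using that(2) by (intro real_le_rsqrt) (auto intro: member_le_sum[of i])
    also have "\<dots> \<le> r"
      unfolding r_def using g[OF that(1)] by (intro clustering_cost_ge[OF assms(4) X]) auto
    finally show ?thesis .
  qed
  then have "splittable d (card S) (spread_le {..<d} L) X"
    unfolding L_def using X S \<open>r \<ge> 0\<close> assms(3) g
    by (intro splittable_around_centers[where f = "\<lambda>x. \<mu> (g x)"]) (auto simp: S_def)
  then have "splittable d k (spread_le {..<d} L) X"
    using S(3) by (rule splittable_mono)
  from explainable_clustering_exists[OF assms(1,2) this]
  obtain P' \<mu>' where P': "clustering d k X P' \<mu>'" "explainable d k X P'"
      "\<forall>G\<in>P'. \<mu>' G \<in> G \<and> (\<exists>H. spread_le {..<d} L H \<and> G \<subseteq> H)" by blast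
  have "clustering_cost d P' \<mu>' \<le> sqrt d * L"
  proof (rule clustering_cost_le[OF P'(1) X])
    fix C x assume "C \<in> P'" "x \<in> C"
    then show "euclidean_dist d x (\<mu>' C) \<le> sqrt d * L"
      using P'(3) \<open>L \<ge> 0\<close> by (intro euclidean_dist_le) (auto simp: spread_le_def subset_iff)
  qed
  \<comment> \<open>Costs are nonnegative, so the set whose infimum is taken is bounded
    below.\<close>
  moreover have "OPT_exp d k X \<le> clustering_cost d P' \<mu>'"
    unfolding OPT_exp_def using P'(1,2) clustering_cost_nonneg[OF _ X]
    by (intro cInf_lower bdd_belowI[of _ 0]) auto
  ultimately show ?thesis
    unfolding L_def r_def by (simp add: algebra_simps)
qed

lemma OPT_exp_le_OPT_unr:
  assumes "kcenters_instance d k X" "k \<ge> 1" "d \<ge> 1"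
  shows "OPT_exp d k X \<le> 4 * sqrt d * real k powr (1 - 1 / d) * OPT_unr d k X"
proof -
  let ?c = "4 * sqrt d * real k powr (1 - 1 / d)"
  have "?c > 0" using assms(2,3) by simp
  \<comment> \<open>The trivial predicate yields some clustering, so that the infimum defining
    \<open>OPT_unr\<close> is over a nonempty set.\<close>
  have "splittable d k (\<lambda>_. True) X" using assms(2) by (intro splittable_leaf) auto
  then have "{clustering_cost d P \<mu> | P \<mu>. clustering d k X P \<mu>} \<noteq> {}"
    using explainable_clustering_exists[OF assms(1,2)] by blast
  then have "OPT_exp d k X / ?c \<le> OPT_unr d k X"
    unfolding OPT_unr_def
  proof (rule cInf_greatest)
    fix c assume "c \<in> {clustering_cost d P \<mu> | P \<mu>. clustering d k X P \<mu>}"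
    then show "OPT_exp d k X / ?c \<le> c"
      using OPT_exp_le_clustering_cost[OF assms] \<open>?c > 0\<close>
      by (auto simp: pos_divide_le_eq mult.commute)
  qed
  then show ?thesis using \<open>?c > 0\<close> by (simp add: pos_divide_le_eq mult.commute)
qed

theorem theorem2:
  shows "\<exists>C::real. C > 0 \<and>
    (\<forall>k d :: nat. k \<ge> 2 \<longrightarrow> d \<ge> 1 \<longrightarrow>
      price_of_explainability k d \<le> ereal (C * sqrt (real d) * real k powr (1 - 1 / real d)))"
proof (intro exI[of _ 4] conjI allI impI)
  fix k d :: nat
  assume "k \<ge> 2" "d \<ge> 1"
  \<comment> \<open>The constant 4 is the product of the 2 in the box side
    \<open>2 * r * card S\<close> and the 2 lost in rounding the root; \<open>sqrt d\<close> comes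
    from passing from coordinates to the Euclidean distance.\<close>
  then show "price_of_explainability k d \<le> ereal (4 * sqrt (real d) * real k powr (1 - 1 / real d))"
    unfolding price_of_explainability_def
    using OPT_exp_le_OPT_unr[of d k] by (intro SUP_least) (auto simp: pos_divide_le_eq)
qed simp

end
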